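(* Let $Q$ be a quiver (finite, without loops and multiple edges) and let $R$ be a lluf subquiver of $Q$ with $\dim(\operatorname{DE}(R))=\dim(\operatorname{DE}(Q))-1$. Then $\operatorname{DE}(R)$ is a facet of $\operatorname{DE}(Q)$ if and only if one of the following holds: (1) $\#\pi_0(R)=\#\pi_0(Q)+1$, each connected component of $R$ is a full subquiver of $Q$, and the contraction $Q/R$ is acyclic; (2) $\#\pi_0(R)=\#\pi_0(Q)$ and there exists a rank function $\rho$ of $R$ such that $(\rho(v)-\rho(w)+1)(\rho(v')-\rho(w')+1)>0$ for all $(v,w),(v',w')\in Q_1\setminus R_1$.
   Context: A quiver is a pair $Q=(Q_0,Q_1)$ with $Q_0$ a finite set and $Q_1\subset (Q_0\times Q_0)\setminus\{(v,v)\mid v\in Q_0\}$. For $v\in Q_0$ let $\kappa_{\{v\}}\in\mathbb{R}^{Q_0}$ be the indicator function of $v$, and $\varepsilon_{(v,w)}=\kappa_{\{v\}}-\kappa_{\{w\}}$. The directed edge polytope is $\operatorname{DE}(Q)=\operatorname{conv}\{\varepsilon_{(v,w)}\mid (v,w)\in Q_1\}\subset\mathbb{R}^{Q_0}$. A subquiver $R$ of $Q$ has $R_0\subset Q_0$, $R_1\subset Q_1$; it is lluf if $R_0=Q_0$, and full if $R_1=\{(v,w)\in Q_1\mid v,w\in R_0\}$. An undirected walk is a sequence $(v_0,\dots,v_n)$ with $(v_t,v_{t+1})\in Q_1$ or $(v_{t+1},v_t)\in Q_1$ for all $t$; connectivity and the set $\pi_0(Q)$ of connected components are defined via undirected walks.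 A quiver is acyclic if it has no directed cycle, i.e.\ no $v_0,\dots,v_n$ with $n>1$, $v_n=v_0$, $(v_t,v_{t+1})\in Q_1$ for all $t$. A rank function of $R$ is $\rho:R_0\to\mathbb{R}$ with $\rho(v)+1=\rho(w)$ for each $(v,w)\in R_1$. Contraction: if each connected component of $R$ is full in $Q$, let $\sim$ be the equivalence relation on $Q_0$ with $v\sim w$ iff $v,w$ are joined by an undirected walk in $R$, with classes $[v]$; then $Q/R$ is the quiver with vertex set $Q_0/\sim$ and edge set $\{([v],[w])\mid (v,w)\in Q_1\setminus R_1\}$. *)

theory Defs
  imports "HOL-Analysis.Analysis"
begin

record 'v quiver =
  verts :: "'v set"
  edges :: "('v \<times> 'v) set"

definition quiver :: "'v quiver \<Rightarrow> bool" where
  "quiver Q \<longleftrightarrow> finite (verts Q) \<and> edges Q \<subseteq> verts Q \<times> verts Q - {(v, v) | v. v \<in> verts Q}"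

definition subquiver :: "'v quiver \<Rightarrow> 'v quiver \<Rightarrow> bool" where
  "subquiver R Q \<longleftrightarrow> quiver R \<and> verts R \<subseteq> verts Q \<and> edges R \<subseteq> edges Q"

definition lluf_subquiver :: "'v quiver \<Rightarrow> 'v quiver \<Rightarrow> bool" where
  "lluf_subquiver R Q \<longleftrightarrow> subquiver R Q \<and> verts R = verts Q"

definition full_subquiver :: "'v quiver \<Rightarrow> 'v quiver \<Rightarrow> bool" where
  "full_subquiver R Q \<longleftrightarrow> subquiver R Q \<and>
     edges R = {(v, w). (v, w) \<in> edges Q \<and> v \<in> verts R \<and> w \<in> verts R}"

text \<open>
  A sequence \<open>v\<^sub>0, \<dots>, v\<^sub>n\<close> is a list of length \<open>n + 1\<close>; the
  constant walk (\<open>n = 0\<close>) at a vertex is allowed.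
\<close>

definition undirected_walk :: "'v quiver \<Rightarrow> 'v list \<Rightarrow> bool" where
  "undirected_walk Q vs \<longleftrightarrow> vs \<noteq> [] \<and> set vs \<subseteq> verts Q \<and>
     successively (\<lambda>v w. (v, w) \<in> edges Q \<or> (w, v) \<in> edges Q) vs"

definition walk_rel :: "'v quiver \<Rightarrow> 'v rel" where
  "walk_rel Q = {(v, w). \<exists>vs. undirected_walk Q vs \<and> hd vs = v \<and> last vs = w}"

definition restrict_quiver :: "'v quiver \<Rightarrow> 'v set \<Rightarrow> 'v quiver" where
  "restrict_quiver Q C = \<lparr>verts = C, edges = {(v, w). (v, w) \<in> edges Q \<and> v \<in> C \<and> w \<in> C}\<rparr>"

text \<open>Connected components are subquivers, not merely sets of vertices.\<close>

definition pi0 :: "'v quiver \<Rightarrow> 'v quiver set" where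
  "pi0 Q = restrict_quiver Q ` (verts Q // walk_rel Q)"

definition acyclic_quiver :: "'v quiver \<Rightarrow> bool" where
  "acyclic_quiver Q \<longleftrightarrow>
     \<not> (\<exists>vs. length vs > 2 \<and> last vs = hd vs \<and> successively (\<lambda>v w. (v, w) \<in> edges Q) vs)"

definition rank_function :: "'v quiver \<Rightarrow> ('v \<Rightarrow> real) \<Rightarrow> bool" where
  "rank_function R \<rho> \<longleftrightarrow> (\<forall>(v, w) \<in> edges R. \<rho> v + 1 = \<rho> w)"

text \<open>
  The diagonal makes vertices of \<open>Q\<close> outside \<open>R\<close> equivalent to themselves; it adds nothing
  when \<open>R\<close> is lluf. The contraction is meaningful (loop-free) only when each connected
  component of \<open>R\<close> is full in \<open>Q\<close>.
\<close>

definition contract_rel :: "'v quiver \<Rightarrow> 'v quiver \<Rightarrow> 'v rel" where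
  "contract_rel Q R = Id_on (verts Q) \<union> walk_rel R"

definition contraction :: "'v quiver \<Rightarrow> 'v quiver \<Rightarrow> 'v set quiver" where
  "contraction Q R =
     \<lparr>verts = verts Q // contract_rel Q R,
      edges = {(contract_rel Q R `` {v}, contract_rel Q R `` {w}) | v w.
                 (v, w) \<in> edges Q - edges R}\<rparr>"

text \<open>
  The ambient space \<open>\<real>\<^sup>V\<close> with \<open>V = verts Q\<close> is the coordinate subspace of \<open>real^'v\<close> of
  vectors vanishing off \<open>verts Q\<close> (all of \<open>real^'v\<close> if \<open>verts Q = UNIV\<close>); \<open>axis v 1\<close> is the
  indicator function of \<open>v\<close>.
\<close>

definition edge_vec :: "'v \<times> 'v \<Rightarrow> real ^ 'v::finite" where
  "edge_vec e = axis (fst e) 1 - axis (snd e) 1"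

definition DE :: "'v::finite quiver \<Rightarrow> (real ^ 'v) set" where
  "DE Q = convex hull (edge_vec ` edges Q)"

text \<open>
  Unlike \<open>facet_of\<close>, this does not exclude the empty face: with \<open>dim {} = -1\<close>, the empty set
  is a facet of a point. This case occurs when \<open>Q\<close> has one edge and \<open>R\<close> has none.
\<close>

definition polytope_facet :: "'a::euclidean_space set \<Rightarrow> 'a set \<Rightarrow> bool" where
  "polytope_facet F P \<longleftrightarrow> F face_of P \<and> aff_dim F = aff_dim P - 1"

end

theory Submission
  imports Defs
begin

text \<open>
  The edge vectors lie on a sphere, so \<open>DE R\<close> is a face of \<open>DE Q\<close> iff some \<open>f\<close> and \<open>c\<close> satisfy
  \<open>f v - f w = c\<close> on the edges of \<open>R\<close> and \<open>f v - f w < c\<close> on the other edges of \<open>Q\<close>.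
  The dimension of \<open>DE Q\<close> is \<open>|V| - #\<pi>\<^sub>0(Q)\<close>, minus \<open>1\<close> if \<open>Q\<close> has a rank function, so codimension
  one means that passing to \<open>R\<close> either creates one new component or creates rank functions.
  In the first case one may take \<open>c = 0\<close>, and \<open>f\<close> is a strictly increasing potential on
  \<open>Q/R\<close>; in the second \<open>c\<close> is nonzero and \<open>- f / c\<close> is the required rank function.
\<close>

section \<open>Components as classes of a symmetric closure\<close>

text \<open>The reflexive closure relates every element of the type to itself, while a walk stays
  inside \<open>verts Q\<close>; hence the two membership conditions.\<close>

lemma exists_walk_iff_rtrancl:
  "(\<exists>vs. undirected_walk Q vs \<and> hd vs = v \<and> last vs = w) \<longleftrightarrow>
    v \<in> verts Q \<and> w \<in> verts Q \<and> (v, w) \<in> (edges Q \<union> (edges Q)\<inverse>)\<^sup>*"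
  if "quiver Q"
proof
  assume "\<exists>vs. undirected_walk Q vs \<and> hd vs = v \<and> last vs = w"
  then obtain vs where "undirected_walk Q vs" "hd vs = v" "last vs = w" by blast
  then show "v \<in> verts Q \<and> w \<in> verts Q \<and> (v, w) \<in> (edges Q \<union> (edges Q)\<inverse>)\<^sup>*"
  proof (induction vs arbitrary: v)
    case Nil
    then show ?case by (simp add: undirected_walk_def)
  next
    case (Cons x xs)
    show ?case
    proof (cases "xs = []")
      case True
      then show ?thesis using Cons.prems by (auto simp: undirected_walk_def)
    next
      case False
      have *: "undirected_walk Q xs" "(x, hd xs) \<in> edges Q \<union> (edges Q)\<inverse>" "x \<in> verts Q"
        using Cons.prems False by (auto simp: undirected_walk_def successively_Cons)
      then show ?thesis using Cons.IH[OF *(1) refl] Cons.prems False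
        by (auto intro: converse_rtrancl_into_rtrancl)
    qed
  qed
next
  assume "v \<in> verts Q \<and> w \<in> verts Q \<and> (v, w) \<in> (edges Q \<union> (edges Q)\<inverse>)\<^sup>*"
  then have v: "v \<in> verts Q" and w: "w \<in> verts Q"
    and r: "(v, w) \<in> (edges Q \<union> (edges Q)\<inverse>)\<^sup>*" by auto
  from r v show "\<exists>vs. undirected_walk Q vs \<and> hd vs = v \<and> last vs = w"
  proof (induction rule: converse_rtrancl_induct)
    case base
    then show ?case using w by (intro exI[of _ "[w]"]) (auto simp: undirected_walk_def)
  next
    case (step y z)
    then have "z \<in> verts Q" using that by (auto simp: quiver_def)
    then obtain vs where "undirected_walk Q vs" "hd vs = z" "last vs = w" using step by blast
    then show ?case using step
      by (intro exI[of _ "y # vs"]) (auto simp: undirected_walk_def successively_Cons)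
  qed
qed

lemma walk_rel_eq:
  assumes "quiver Q"
  shows "walk_rel Q = {(v, w). v \<in> verts Q \<and> w \<in> verts Q \<and>
    (v, w) \<in> (edges Q \<union> (edges Q)\<inverse>)\<^sup>*}"
  unfolding walk_rel_def using exists_walk_iff_rtrancl[OF assms] by auto

lemma equiv_rtrancl_sym: "equiv UNIV ((r \<union> r\<inverse>)\<^sup>*)"
  by (intro equivI refl_rtrancl sym_rtrancl sym_Un_converse trans_rtrancl) simp

lemma equiv_walk_rel:
  assumes "quiver Q"
  shows "equiv (verts Q) (walk_rel Q)"
proof (rule equivI)
  note eqv = equiv_rtrancl_sym[of "edges Q"]
  show "sym (walk_rel Q)"
    using eqv unfolding walk_rel_eq[OF assms] equiv_def by (auto intro!: symI dest: symD)
  show "trans (walk_rel Q)"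
    unfolding walk_rel_eq[OF assms] by (rule transI) (auto intro: rtrancl_trans)
qed (auto simp: walk_rel_eq[OF assms] refl_on_def)

lemma rtrancl_sym_const:
  assumes "(v, w) \<in> (r \<union> r\<inverse>)\<^sup>*" "\<And>x y. (x, y) \<in> r \<Longrightarrow> f x = f y"
  shows "f v = f w"
  using assms(1) by (induction rule: rtrancl_induct) (auto dest: assms(2))

text \<open>Edges never leave \<open>verts Q\<close>, so each element of the type outside it is a
  singleton class. Counting classes on all of \<open>UNIV\<close> matches the ambient space
  \<open>real ^ 'v\<close> of the dimension argument.\<close>

lemma card_pi0:
  assumes "quiver (Q :: 'v::finite quiver)"
  shows "card (UNIV // (edges Q \<union> (edges Q)\<inverse>)\<^sup>*) = card (pi0 Q) + card (- verts Q)"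
proof -
  let ?W = "(edges Q \<union> (edges Q)\<inverse>)\<^sup>*"
  have stay: "w \<in> verts Q \<longleftrightarrow> v \<in> verts Q" if "(v, w) \<in> ?W" for v w
    using rtrancl_sym_const[OF that, of "\<lambda>x. x \<in> verts Q"] assms by (auto simp: quiver_def)
  have in_V: "?W `` {v} = walk_rel Q `` {v}" if "v \<in> verts Q" for v
    using stay that by (auto simp: walk_rel_eq[OF assms])
  have out_V: "?W `` {v} = {v}" if "v \<notin> verts Q" for v
  proof -
    have "w = v" if "(v, w) \<in> ?W" for w
      using that \<open>v \<notin> verts Q\<close> assms
      by (induction rule: converse_rtrancl_induct) (auto simp: quiver_def)
    then show ?thesis by auto
  qed
  have quot: "A // r = (\<lambda>v. r `` {v}) ` A" for A and r :: "'v rel"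
    by (auto simp: quotient_def)
  have "UNIV // ?W = (\<lambda>v. ?W `` {v}) ` verts Q \<union> (\<lambda>v. ?W `` {v}) ` (- verts Q)"
    unfolding quot image_Un[symmetric] by simp
  also have "\<dots> = verts Q // walk_rel Q \<union> (\<lambda>v. {v}) ` (- verts Q)"
    unfolding quot using in_V out_V by (intro arg_cong2[where f = "(\<union>)"] image_cong) auto
  finally have "UNIV // ?W = verts Q // walk_rel Q \<union> (\<lambda>v. {v}) ` (- verts Q)" .
  moreover have "verts Q // walk_rel Q \<inter> (\<lambda>v. {v}) ` (- verts Q) = {}"
    unfolding quotient_def by (auto simp: walk_rel_eq[OF assms])
  ultimately have "card (UNIV // ?W) = card (verts Q // walk_rel Q) + card ((\<lambda>v. {v}) ` (- verts Q))"
    by (simp add: card_Un_disjoint)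
  \<comment> \<open>The restriction of \<open>Q\<close> to a class records that class as its vertex
    set, so distinct classes give distinct components.\<close>
  moreover have "card (pi0 Q) = card (verts Q // walk_rel Q)"
    unfolding pi0_def by (intro card_image inj_onI) (simp add: restrict_quiver_def)
  ultimately show ?thesis by (simp add: card_image)
qed

section \<open>Linear span of the edge vectors\<close>

lemma inner_edge_vec: "a \<bullet> edge_vec e = a $ fst e - a $ snd e"
  by (simp add: edge_vec_def inner_diff_right inner_axis)

text \<open>The functions constant on all components form the orthogonal complement of the edge vectors.\<close>

lemma dim_edge_vecs:
  assumes "quiver (Q :: 'v::finite quiver)"
  shows "dim (edge_vec ` edges Q) + card (pi0 Q) + card (- verts Q) = CARD('v)"
proof -
  let ?W = "(edges Q \<union> (edges Q)\<inverse>)\<^sup>*"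
  let ?E = "edge_vec ` edges Q"
  define ind :: "'v set \<Rightarrow> real ^ 'v" where "ind K = (\<chi> i. of_bool (i \<in> K))" for K
  have eqv: "equiv UNIV ?W" by (rule equiv_rtrancl_sym)
  have ind_inner: "x \<bullet> ind K = (\<Sum>i\<in>K. x $ i)" for x K
    unfolding ind_def inner_vec_def by (simp add: of_bool_def if_distrib sum.If_cases cong: if_cong)
  have inj: "inj_on ind A" for A
    by (auto simp: inj_on_def ind_def vec_eq_iff set_eq_iff)
  have nz: "0 \<notin> ind ` (UNIV // ?W)"
    using in_quotient_imp_non_empty[OF eqv] by (fastforce simp: ind_def vec_eq_iff)
  \<comment> \<open>Distinct classes are disjoint, so their indicators are orthogonal; being nonzero
    as well, they form a basis of their span.\<close>
  have orth: "pairwise orthogonal (ind ` (UNIV // ?W))"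
    unfolding pairwise_def
  proof (intro ballI impI)
    fix x y assume xy: "x \<in> ind ` (UNIV // ?W)" "y \<in> ind ` (UNIV // ?W)" "x \<noteq> y"
    then obtain K L where KL: "x = ind K" "y = ind L" "K \<in> UNIV // ?W" "L \<in> UNIV // ?W" by blast
    then have "K \<inter> L = {}" using quotient_disj[OF eqv] xy by blast
    then have "(\<Sum>i\<in>L. ind K $ i) = 0"
      by (intro sum.neutral) (auto simp: ind_def)
    then show "orthogonal x y"
      by (simp add: orthogonal_def KL ind_inner)
  qed
  have eq: "{y \<in> UNIV. \<forall>x \<in> span ?E. orthogonal x y} = span (ind ` (UNIV // ?W))" (is "?L = ?R")
  proof
    show "?R \<subseteq> ?L"
    proof (rule span_minimal)
      show "subspace ?L"
        by (auto simp: subspace_def orthogonal_clauses)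
      have "orthogonal x (ind K)" if K: "K \<in> UNIV // ?W" and x: "x \<in> span ?E" for x K
      proof -
        have "orthogonal (ind K) (edge_vec e)" if "e \<in> edges Q" for e
        proof -
          obtain v w where e: "e = (v, w)" by force
          then have "(v, w) \<in> ?W" using that by auto
          then have "v \<in> K \<longleftrightarrow> w \<in> K"
            using in_quotient_imp_closed[OF eqv K] eqv by (meson equiv_def symD)
          then show ?thesis by (simp add: orthogonal_def e inner_edge_vec ind_def)
        qed
        then have "orthogonal (ind K) x"
          using x by (intro orthogonal_to_span[of x ?E]) auto
        then show ?thesis by (simp add: orthogonal_commute)
      qed
      then show "ind ` (UNIV // ?W) \<subseteq> ?L" by auto
    qed
    show "?L \<subseteq> ?R"
    proof
      fix y assume y: "y \<in> ?L"
      have "y $ v = y $ w" if "(v, w) \<in> edges Q" for v w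
      proof -
        have "orthogonal (edge_vec (v, w)) y" using y that by (auto intro: span_base)
        then show ?thesis
          by (simp add: orthogonal_def inner_commute[of _ y] inner_edge_vec)
      qed
      then have const: "y $ v = y $ w" if "(v, w) \<in> ?W" for v w
        using rtrancl_sym_const[OF that, of "($) y"] by blast
      \<comment> \<open>The coefficient of \<open>ind K\<close> in \<open>y\<close> is the common
        value of \<open>y\<close> on the class \<open>K\<close>, read off at a chosen
        representative.\<close>
      define rep :: "'v set \<Rightarrow> 'v" where "rep K = (SOME v. v \<in> K)" for K
      have "y = (\<Sum>K \<in> UNIV // ?W. (y $ rep K) *\<^sub>R ind K)"
      proof (subst vec_eq_iff, intro allI)
        fix i
        have i: "?W `` {i} \<in> UNIV // ?W" by (simp add: quotientI)
        have "(\<Sum>K \<in> UNIV // ?W. (y $ rep K) *\<^sub>R ind K) $ i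
            = (\<Sum>K \<in> UNIV // ?W. if K = ?W `` {i} then y $ rep K else 0)"
          unfolding sum_component
        proof (rule sum.cong[OF refl])
          fix K assume "K \<in> UNIV // ?W"
          then have "i \<in> K \<longleftrightarrow> K = ?W `` {i}"
            using quotient_disj[OF eqv _ i] by auto
          then show "((y $ rep K) *\<^sub>R ind K) $ i = (if K = ?W `` {i} then y $ rep K else 0)"
            by (simp add: ind_def)
        qed
        also have "\<dots> = y $ rep (?W `` {i})" using i by simp
        also have "\<dots> = y $ i"
        proof -
          have "rep (?W `` {i}) \<in> ?W `` {i}" unfolding rep_def by (rule someI[of _ i]) auto
          then show ?thesis using const[of i "rep (?W `` {i})"] by auto
        qed
        finally show "y $ i = (\<Sum>K \<in> UNIV // ?W. (y $ rep K) *\<^sub>R ind K) $ i" ..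
      qed
      then show "y \<in> ?R"
        by (metis (no_types, lifting) imageI span_base span_scale span_sum)
    qed
  qed
  have "dim (ind ` (UNIV // ?W)) = card (ind ` (UNIV // ?W))"
    using pairwise_orthogonal_independent[OF orth nz] by (rule dim_eq_card_independent)
  then have "dim ?R = card (pi0 Q) + card (- verts Q)"
    using card_image[OF inj] card_pi0[OF assms] by (simp add: dim_span)
  moreover have "dim ?L + dim (span ?E) = dim (UNIV :: (real ^ 'v) set)"
    by (rule dim_subspace_orthogonal_to_vectors) (auto simp: subspace_span)
  ultimately show ?thesis unfolding eq by (simp add: dim_span)
qed

section \<open>Affine dimension and rank functions\<close>

text \<open>For the construction of \<open>a\<close>, split a point \<open>x0\<close> of
  \<open>S\<close> into a part along the direction space of the affine hull and a part
  \<open>z\<close> orthogonal to it. If \<open>0\<close> is outside the hull, \<open>z\<close> is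
  nonzero, and \<open>z \<bullet> x\<close> has the constant value \<open>z \<bullet> z\<close> on
  \<open>S\<close>; rescaling gives the value 1.\<close>

lemma zero_notin_affine_hull_iff:
  fixes S :: "'a::euclidean_space set"
  shows "0 \<notin> affine hull S \<longleftrightarrow> (\<exists>a. \<forall>x\<in>S. a \<bullet> x = 1)"
proof
  assume "\<exists>a. \<forall>x\<in>S. a \<bullet> x = 1"
  then obtain a where "\<forall>x\<in>S. a \<bullet> x = 1" by blast
  then have "affine hull S \<subseteq> {x. a \<bullet> x = 1}"
    by (intro hull_minimal) (auto simp: affine_hyperplane)
  then show "0 \<notin> affine hull S" by auto
next
  assume 0: "0 \<notin> affine hull S"
  show "\<exists>a. \<forall>x\<in>S. a \<bullet> x = 1"
  proof (cases "S = {}")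
    case False
    then obtain x0 where x0: "x0 \<in> S" by blast
    let ?D = "(+) (- x0) ` (S - {x0})"
    obtain y z where y: "y \<in> span ?D" and z: "\<And>w. w \<in> span ?D \<Longrightarrow> orthogonal z w"
      and x0_eq: "x0 = y + z"
      using orthogonal_subspace_decomp_exists[of ?D x0] by metis
    have "z \<noteq> 0"
    proof
      assume "z = 0"
      then have "- x0 \<in> span ?D" using y x0_eq by (simp add: span_neg)
      then have "x0 + - x0 \<in> affine hull S"
        unfolding affine_hull_span2[OF x0] by (rule imageI)
      then show False using 0 by simp
    qed
    moreover have "z \<bullet> x = z \<bullet> z" if "x \<in> S" for x
    proof -
      have "x - x0 \<in> span ?D"
      proof (cases "x = x0")
        case False
        then have "- x0 + x \<in> ?D" using that by blast
        then show ?thesis by (simp add: span_base)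
      qed (simp add: span_zero)
      then have "z \<bullet> (x - x0) = 0" using z by (simp add: orthogonal_def)
      moreover have "z \<bullet> y = 0" using z[OF y] by (simp add: orthogonal_def)
      ultimately show ?thesis using x0_eq by (simp add: inner_diff_right inner_add_right)
    qed
    ultimately show ?thesis by (intro exI[of _ "z /\<^sub>R (z \<bullet> z)"]) auto
  qed auto
qed

text \<open>If \<open>0\<close> lies outside the affine hull, inserting it raises the affine
  dimension by one and leaves the span unchanged. The empty set is covered: the condition on
  \<open>a\<close> is vacuous and the value is -1.\<close>

lemma aff_dim_eq_dim:
  fixes S :: "'a::euclidean_space set"
  shows "aff_dim S = int (dim S) - of_bool (\<exists>a. \<forall>x\<in>S. a \<bullet> x = 1)"
proof (cases "0 \<in> affine hull S")
  case True
  then show ?thesis using aff_dim_zero zero_notin_affine_hull_iff[of S] by auto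
next
  case False
  have "aff_dim (insert 0 S) = int (dim (insert 0 S))"
    by (rule aff_dim_zero) (simp add: hull_inc)
  moreover have "dim (insert 0 S) = dim S" by (metis dim_span span_insert_0)
  ultimately show ?thesis using False zero_notin_affine_hull_iff[of S] by (auto simp: aff_dim_insert)
qed

text \<open>Edge vectors are source minus target, whereas a rank function grows towards the target;
  hence the change of sign between \<open>a\<close> and \<open>\<rho>\<close>.\<close>

lemma rank_function_iff_inner:
  "(\<exists>\<rho>. rank_function Q \<rho>) \<longleftrightarrow> (\<exists>a. \<forall>x \<in> edge_vec ` edges Q. a \<bullet> x = 1)"
proof
  assume "\<exists>\<rho>. rank_function Q \<rho>"
  then obtain \<rho> where \<rho>: "rank_function Q \<rho>" by blast
  have "\<forall>x \<in> edge_vec ` edges Q. (\<chi> i. - \<rho> i) \<bullet> x = 1"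
    using \<rho> by (auto simp: rank_function_def inner_edge_vec dest!: bspec)
  then show "\<exists>a. \<forall>x \<in> edge_vec ` edges Q. a \<bullet> x = 1" by blast
next
  assume "\<exists>a. \<forall>x \<in> edge_vec ` edges Q. a \<bullet> x = 1"
  then obtain a where a: "\<forall>x \<in> edge_vec ` edges Q. a \<bullet> x = 1" by blast
  have "rank_function Q (\<lambda>v. - (a $ v))"
    using a by (force simp: rank_function_def inner_edge_vec)
  then show "\<exists>\<rho>. rank_function Q \<rho>" by blast
qed

lemma aff_dim_DE:
  assumes "quiver (Q :: 'v::finite quiver)"
  shows "aff_dim (DE Q) = int CARD('v) - int (card (- verts Q)) - int (card (pi0 Q))
    - of_bool (\<exists>\<rho>. rank_function Q \<rho>)"
  unfolding DE_def aff_dim_convex_hull aff_dim_eq_dim[of "edge_vec ` edges Q"] rank_function_iff_inner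
  using dim_edge_vecs[OF assms] by linarith

section \<open>Faces of convex hulls of points on a sphere\<close>

text \<open>By strict convexity of the ball, every other point \<open>y\<close> of the sphere
  satisfies \<open>x \<bullet> y < x \<bullet> x\<close>. If \<open>x\<close> were not in
  \<open>T\<close>, this open half-space would contain the hull of \<open>T\<close> but not
  \<open>x\<close>.\<close>

lemma sphere_convex_hull_mem:
  fixes T :: "'a::euclidean_space set"
  assumes "x \<in> convex hull T" "T \<subseteq> sphere 0 r" "norm x = r"
  shows "x \<in> T"
proof (rule ccontr)
  assume "x \<notin> T"
  have "x \<bullet> y < x \<bullet> x" if "y \<in> T" for y
  proof -
    have "y \<bullet> y = x \<bullet> x" using assms that by (auto simp: dot_square_norm)
    moreover have "0 < (x - y) \<bullet> (x - y)" using that \<open>x \<notin> T\<close> by auto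
    ultimately show ?thesis by (simp add: inner_diff_left inner_diff_right inner_commute)
  qed
  then have "convex hull T \<subseteq> {y. x \<bullet> y < x \<bullet> x}"
    by (intro hull_minimal) (auto simp: convex_halfspace_lt)
  then show False using assms by auto
qed

text \<open>Faces of a polytope are exposed, which supplies \<open>a\<close> and \<open>b\<close>.
  The inequality is strict off \<open>T\<close> because no point of \<open>S - T\<close> lies in the
  hull of \<open>T\<close>, all points being on one sphere.\<close>

lemma face_of_convex_hull_sphere_iff:
  fixes S T :: "'a::euclidean_space set"
  assumes "finite S" "T \<subseteq> S" "S \<subseteq> sphere 0 r"
  shows "convex hull T face_of convex hull S \<longleftrightarrow>
    (\<exists>a b. (\<forall>x\<in>T. a \<bullet> x = b) \<and> (\<forall>x\<in>S - T. a \<bullet> x < b))"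
proof
  assume "convex hull T face_of convex hull S"
  then have "convex hull T exposed_face_of convex hull S"
    using exposed_face_of_polyhedron polyhedron_convex_hull[OF assms(1)] by blast
  then obtain a b where le: "convex hull S \<subseteq> {x. a \<bullet> x \<le> b}"
    and eq: "convex hull T = convex hull S \<inter> {x. a \<bullet> x = b}"
    unfolding exposed_face_of_def by blast
  have "a \<bullet> x = b" if "x \<in> T" for x using eq hull_inc[OF that, of convex] by auto
  moreover have "a \<bullet> x < b" if "x \<in> S - T" for x
  proof -
    have "x \<in> convex hull S" using that by (auto intro: hull_inc)
    moreover have "x \<notin> convex hull T"
      using sphere_convex_hull_mem[of x T r] assms(2,3) that by (auto simp: subset_iff)
    ultimately have "a \<bullet> x \<le> b" "a \<bullet> x \<noteq> b" using le eq by blast+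
    then show ?thesis by simp
  qed
  ultimately show "\<exists>a b. (\<forall>x\<in>T. a \<bullet> x = b) \<and> (\<forall>x\<in>S - T. a \<bullet> x < b)"
    by (intro exI[of _ a] exI[of _ b] conjI ballI)
next
  assume "\<exists>a b. (\<forall>x\<in>T. a \<bullet> x = b) \<and> (\<forall>x\<in>S - T. a \<bullet> x < b)"
  then obtain a b where "\<forall>x\<in>T. a \<bullet> x = b" "\<forall>x\<in>S - T. a \<bullet> x < b"
    by (elim exE conjE) (rule that)
  then have ab: "\<And>x. x \<in> T \<Longrightarrow> a \<bullet> x = b" "\<And>x. x \<in> S - T \<Longrightarrow> a \<bullet> x < b" by simp_all
  let ?F = "convex hull S \<inter> {x. a \<bullet> x = b}"
  have "a \<bullet> x \<le> b" if "x \<in> S" for x using ab(1)[of x] ab(2)[of x] that by fastforce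
  then have "convex hull S \<subseteq> {x. a \<bullet> x \<le> b}"
    by (intro hull_minimal) (auto simp: convex_halfspace_le)
  then have face: "?F face_of convex hull S"
    by (intro face_of_Int_supporting_hyperplane_le) auto
  \<comment> \<open>A face of a hull is the hull of some of the generators; strictness off
    \<open>T\<close> then forces these generators into \<open>T\<close>.\<close>
  obtain S' where S': "S' \<subseteq> S" "?F = convex hull S'"
    using face_of_convex_hull_subset[OF finite_imp_compact[OF assms(1)] face] by blast
  have "S' \<subseteq> T"
  proof
    fix x assume "x \<in> S'"
    then have "x \<in> ?F" using S'(2) by (simp add: hull_inc)
    then show "x \<in> T" using ab(2)[of x] \<open>x \<in> S'\<close> S'(1) by auto
  qed
  then have "?F \<subseteq> convex hull T" using S'(2) by (simp add: hull_mono)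
  moreover have "convex hull T \<subseteq> ?F"
    using assms(2) ab(1) by (intro hull_minimal convex_Int) (auto simp: convex_hyperplane hull_inc)
  ultimately show "convex hull T face_of convex hull S" using face by auto
qed

text \<open>The coordinates with values 1 and -1 reveal the source and the target.\<close>

lemma edge_vec_inj:
  assumes "v \<noteq> w" "edge_vec (v, w) = edge_vec (v', w')"
  shows "v' = v \<and> w' = w"
proof -
  have "edge_vec (v, w) $ v = edge_vec (v', w') $ v" "edge_vec (v, w) $ w = edge_vec (v', w') $ w"
    using assms(2) by simp_all
  then show ?thesis using assms(1) by (auto simp: edge_vec_def axis_def split: if_splits)
qed

text \<open>Without loops, all edge vectors have length \<open>sqrt 2\<close> and distinct edges
  have distinct vectors. So the sphere criterion applies, and the vectors outside the image of
  \<open>edges R\<close> are exactly those of the edges outside \<open>R\<close>.\<close>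

lemma DE_face_iff:
  fixes Q R :: "'v::finite quiver"
  assumes "quiver Q" "edges R \<subseteq> edges Q"
  shows "DE R face_of DE Q \<longleftrightarrow>
    (\<exists>(f :: 'v \<Rightarrow> real) c. (\<forall>(v, w) \<in> edges R. f v - f w = c) \<and> (\<forall>(v, w) \<in> edges Q - edges R. f v - f w < c))"
proof -
  have loopfree: "v \<noteq> w" if "(v, w) \<in> edges Q" for v w
    using assms(1) that by (auto simp: quiver_def)
  have "edge_vec ` edges Q \<subseteq> sphere 0 (sqrt 2)"
  proof clarsimp
    fix v w assume "(v, w) \<in> edges Q"
    then have "edge_vec (v, w) \<bullet> edge_vec (v, w) = 2"
      unfolding inner_edge_vec using loopfree by (auto simp: edge_vec_def axis_def)
    then show "norm (edge_vec (v, w)) = sqrt 2" by (simp add: norm_eq_sqrt_inner)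
  qed
  moreover have "finite (edge_vec ` edges Q)"
    by (rule finite_imageI) simp
  moreover have diff: "edge_vec ` edges Q - edge_vec ` edges R = edge_vec ` (edges Q - edges R)"
  proof (rule inj_on_image_set_diff[symmetric, of _ "edges Q"])
    show "inj_on edge_vec (edges Q)"
      unfolding inj_on_def using edge_vec_inj[OF loopfree] by auto
  qed (use assms(2) in auto)
  ultimately have "DE R face_of DE Q \<longleftrightarrow> (\<exists>a c. (\<forall>x \<in> edge_vec ` edges R. a \<bullet> x = c) \<and>
      (\<forall>x \<in> edge_vec ` (edges Q - edges R). a \<bullet> x < c))"
    using face_of_convex_hull_sphere_iff[of "edge_vec ` edges Q" "edge_vec ` edges R" "sqrt 2"] assms(2)
    unfolding DE_def by (simp add: image_mono)
  also have "\<dots> \<longleftrightarrow> (\<exists>(a :: real ^ 'v) c. (\<forall>(v, w) \<in> edges R. a $ v - a $ w = c) \<and>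
      (\<forall>(v, w) \<in> edges Q - edges R. a $ v - a $ w < c))"
    by (simp add: inner_edge_vec split_beta)
  also have "\<dots> \<longleftrightarrow> (\<exists>(f :: 'v \<Rightarrow> real) c. (\<forall>(v, w) \<in> edges R. f v - f w = c) \<and>
      (\<forall>(v, w) \<in> edges Q - edges R. f v - f w < c))"
    (is "?A \<longleftrightarrow> ?B")
  proof
    assume ?B
    then obtain f :: "'v \<Rightarrow> real" and c where "\<forall>(v, w) \<in> edges R. f v - f w = c"
      "\<forall>(v, w) \<in> edges Q - edges R. f v - f w < c" by auto
    then show ?A by (intro exI[of _ "\<chi> i. f i"] exI[of _ c]) simp
  next
    assume ?A
    then obtain a :: "real ^ 'v" and c where "\<forall>(v, w) \<in> edges R. a $ v - a $ w = c"
      "\<forall>(v, w) \<in> edges Q - edges R. a $ v - a $ w < c" by auto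
    then show ?B by (intro exI[of _ "($) a"] exI[of _ c]) simp
  qed
  finally show ?thesis .
qed

section \<open>Acyclicity and potentials on the contraction\<close>

lemma successively_trancl:
  assumes "successively (\<lambda>v w. (v, w) \<in> r) vs" "length vs \<ge> 2"
  shows "(hd vs, last vs) \<in> r\<^sup>+"
  using assms
proof (induction vs)
  case (Cons x xs)
  show ?case
  proof (cases "length xs \<ge> 2")
    case True
    then have "(hd xs, last xs) \<in> r\<^sup>+" "(x, hd xs) \<in> r" "xs \<noteq> []"
      using Cons by (auto simp: successively_Cons)
    then show ?thesis by auto
  next
    case False
    then obtain y where "xs = [y]" using Cons.prems by (cases xs; cases "tl xs") auto
    then show ?thesis using Cons.prems by auto
  qed
qed auto

lemma trancl_successively:
  assumes "(v, w) \<in> r\<^sup>+"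
  shows "\<exists>vs. successively (\<lambda>v w. (v, w) \<in> r) vs \<and> length vs \<ge> 2 \<and> hd vs = v \<and> last vs = w"
  using assms
proof (induction rule: converse_trancl_induct)
  case (base y)
  then show ?case by (intro exI[of _ "[y, w]"]) auto
next
  case (step y z)
  then obtain vs where "successively (\<lambda>v w. (v, w) \<in> r) vs" "length vs \<ge> 2" "hd vs = z" "last vs = w"
    by blast
  then show ?case using step
    by (intro exI[of _ "y # vs"]) (auto simp: successively_Cons)
qed

lemma acyclic_quiver_iff_acyclic: "acyclic_quiver Q \<longleftrightarrow> acyclic (edges Q)"
proof
  assume Q: "acyclic_quiver Q"
  show "acyclic (edges Q)"
  proof (rule acyclicI, rule allI, rule notI)
    fix x assume "(x, x) \<in> (edges Q)\<^sup>+"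
    then obtain vs where vs: "successively (\<lambda>v w. (v, w) \<in> edges Q) vs" "length vs \<ge> 2"
      "hd vs = x" "last vs = x" using trancl_successively by metis
    \<comment> \<open>A loop at \<open>x\<close> also violates \<open>acyclic_quiver\<close>, through the walk \<open>x, x, x\<close>.\<close>
    have "\<exists>ws. length ws > 2 \<and> last ws = hd ws \<and> successively (\<lambda>v w. (v, w) \<in> edges Q) ws"
    proof (cases "length vs > 2")
      case False
      then have "length vs = Suc (Suc 0)" using vs(2) by simp
      then obtain a b where "vs = [a, b]" by (auto simp: length_Suc_conv)
      then show ?thesis using vs by (intro exI[of _ "[x, x, x]"]) auto
    qed (use vs in auto)
    then show False using Q by (simp add: acyclic_quiver_def)
  qed
next
  assume "acyclic (edges Q)"
  then show "acyclic_quiver Q"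
    unfolding acyclic_quiver_def acyclic_def using successively_trancl[of "edges Q"]
    by (metis less_imp_le)
qed

text \<open>The potential of \<open>x\<close> is the number of points reachable from
  \<open>x\<close> by a nonempty path. It drops strictly along \<open>(x, y)\<close>, since
  \<open>y\<close> is reachable from \<open>x\<close> but not from itself.\<close>

lemma acyclic_imp_potential:
  fixes r :: "'a::finite rel"
  assumes "acyclic r"
  obtains g :: "'a \<Rightarrow> nat" where "\<And>x y. (x, y) \<in> r \<Longrightarrow> g y < g x"
proof
  fix x y assume xy: "(x, y) \<in> r"
  then have "r\<^sup>+ `` {y} \<subseteq> r\<^sup>+ `` {x}" by auto
  moreover have "y \<in> r\<^sup>+ `` {x}" "y \<notin> r\<^sup>+ `` {y}" using xy assms by (auto simp: acyclic_def)
  ultimately show "card (r\<^sup>+ `` {y}) < card (r\<^sup>+ `` {x})"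
    by (intro psubset_card_mono) auto
qed

lemma contract_rel_lluf:
  assumes "lluf_subquiver R Q"
  shows "contract_rel Q R = walk_rel R"
proof -
  have R: "quiver R" "verts R = verts Q"
    using assms by (auto simp: lluf_subquiver_def subquiver_def)
  then have "Id_on (verts Q) \<subseteq> walk_rel R" by (auto simp: walk_rel_eq)
  then show ?thesis unfolding contract_rel_def by (rule Un_absorb1)
qed

text \<open>The function \<open>f\<close> is constant on components of \<open>R\<close>, so an edge
  of \<open>Q\<close> within a component cannot increase \<open>f\<close> and must belong to
  \<open>R\<close>. On the contraction, \<open>f\<close> induces a function that increases strictly
  along edges, which rules out cycles.\<close>

lemma level_imp_acyclic_contraction:
  assumes "quiver Q" "lluf_subquiver R Q"
    and eq: "\<And>v w. (v, w) \<in> edges R \<Longrightarrow> f v = f w"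
    and lt: "\<And>v w. (v, w) \<in> edges Q - edges R \<Longrightarrow> f v < (f w :: real)"
  shows "(\<forall>C \<in> pi0 R. full_subquiver C Q) \<and> acyclic_quiver (contraction Q R)"
proof
  have R: "quiver R" "edges R \<subseteq> edges Q" "verts R = verts Q"
    using assms(2) by (auto simp: lluf_subquiver_def subquiver_def)
  have const: "f v = f w" if "(v, w) \<in> walk_rel R" for v w
    using that rtrancl_sym_const[of v w "edges R" f] eq by (auto simp: walk_rel_eq[OF R(1)])
  note eqv = equiv_walk_rel[OF R(1)]
  show "\<forall>C \<in> pi0 R. full_subquiver C Q"
  proof
    fix C assume "C \<in> pi0 R"
    then obtain K where K: "K \<in> verts R // walk_rel R" and C: "C = restrict_quiver R K"
      by (auto simp: pi0_def)
    have KV: "K \<subseteq> verts R" using K eqv in_quotient_imp_subset by blast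
    have "(v, w) \<in> edges R" if "(v, w) \<in> edges Q" "v \<in> K" "w \<in> K" for v w
      using const[of v w] in_quotient_imp_in_rel[OF eqv K, of v w] lt[of v w] that by auto
    then show "full_subquiver C Q"
      using KV R by (auto simp: full_subquiver_def subquiver_def quiver_def C restrict_quiver_def
          intro: finite_subset)
  qed
  \<comment> \<open>All representatives of a class share one value of \<open>f\<close>, so the
    arbitrary choice is harmless.\<close>
  define F where "F X = f (SOME v. v \<in> X)" for X
  have F: "F (walk_rel R `` {v}) = f v" if "v \<in> verts R" for v
  proof -
    have "(SOME u. u \<in> walk_rel R `` {v}) \<in> walk_rel R `` {v}"
      using equiv_class_self[OF eqv that] by (rule someI)
    then show ?thesis using const unfolding F_def by fastforce
  qed
  let ?E = "edges (contraction Q R)"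
  have E: "F X < F Y" if XY: "(X, Y) \<in> ?E" for X Y
  proof -
    obtain v w where vw: "(v, w) \<in> edges Q - edges R" "X = walk_rel R `` {v}" "Y = walk_rel R `` {w}"
      using XY by (auto simp: contraction_def contract_rel_lluf[OF assms(2)])
    then have "v \<in> verts R" "w \<in> verts R" using assms(1) R(3) by (auto simp: quiver_def)
    then show ?thesis using vw lt F by auto
  qed
  have "F X < F Y" if "(X, Y) \<in> ?E\<^sup>+" for X Y
    using that by (induction rule: trancl_induct) (auto dest: E)
  then show "acyclic_quiver (contraction Q R)"
    unfolding acyclic_quiver_iff_acyclic acyclic_def by blast
qed

text \<open>Pull the potential of the contraction back along the class map. It decreases along
  edges, so its negative is taken.\<close>

lemma acyclic_contraction_imp_level:
  fixes Q R :: "'v::finite quiver"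
  assumes "lluf_subquiver R Q" "acyclic_quiver (contraction Q R)"
  obtains f :: "'v \<Rightarrow> real" where "\<And>v w. (v, w) \<in> edges R \<Longrightarrow> f v = f w"
    "\<And>v w. (v, w) \<in> edges Q - edges R \<Longrightarrow> f v < f w"
proof -
  have R: "quiver R" using assms(1) by (auto simp: lluf_subquiver_def subquiver_def)
  note cr = contract_rel_lluf[OF assms(1)]
  obtain g :: "'v set \<Rightarrow> nat" where g: "\<And>X Y. (X, Y) \<in> edges (contraction Q R) \<Longrightarrow> g Y < g X"
    using acyclic_imp_potential assms(2) unfolding acyclic_quiver_iff_acyclic by blast
  show ?thesis
  proof
    fix v w assume "(v, w) \<in> edges R"
    then have "(v, w) \<in> walk_rel R" using R by (auto simp: walk_rel_eq quiver_def)
    then show "- real (g (walk_rel R `` {v})) = - real (g (walk_rel R `` {w}))"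
      using equiv_class_eq[OF equiv_walk_rel[OF R]] by simp
  next
    fix v w assume "(v, w) \<in> edges Q - edges R"
    then have "(walk_rel R `` {v}, walk_rel R `` {w}) \<in> edges (contraction Q R)"
      by (auto simp: contraction_def cr)
    then show "- real (g (walk_rel R `` {v})) < - real (g (walk_rel R `` {w}))"
      using g by simp
  qed
qed

section \<open>The facet criterion from dimension count and face criterion\<close>

theorem theorem1p2:
  fixes Q R :: "'v::finite quiver"
  assumes "quiver Q"
    and "lluf_subquiver R Q"
    and "aff_dim (DE R) = aff_dim (DE Q) - 1"
  shows "polytope_facet (DE R) (DE Q) \<longleftrightarrow>
    (card (pi0 R) = card (pi0 Q) + 1 \<and>
       (\<forall>C \<in> pi0 R. full_subquiver C Q) \<and>
       acyclic_quiver (contraction Q R)) \<or>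
    (card (pi0 R) = card (pi0 Q) \<and>
       (\<exists>\<rho>. rank_function R \<rho> \<and>
          (\<forall>(v, w) \<in> edges Q - edges R. \<forall>(v', w') \<in> edges Q - edges R.
             (\<rho> v - \<rho> w + 1) * (\<rho> v' - \<rho> w' + 1) > 0)))"
    (is "_ \<longleftrightarrow> ?one \<or> ?two")
proof -
  have R: "quiver R" "edges R \<subseteq> edges Q" "verts R = verts Q"
    using assms(2) by (auto simp: lluf_subquiver_def subquiver_def)
  have rank_mono: "rank_function R \<rho>" if "rank_function Q \<rho>" for \<rho>
    using that R(2) by (auto simp: rank_function_def)
  have dims: "int (card (pi0 R)) + of_bool (\<exists>\<rho>. rank_function R \<rho>)
      = int (card (pi0 Q)) + of_bool (\<exists>\<rho>. rank_function Q \<rho>) + 1"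
    using assms(3) aff_dim_DE[OF assms(1)] aff_dim_DE[OF R(1)] R(3) by simp
  \<comment> \<open>Equal edge sets would give equal dimensions. The edge \<open>(v0, w0)\<close>
    outside \<open>R\<close> later refutes \<open>c = 0\<close> and fixes a sign.\<close>
  have "edges R \<noteq> edges Q" using assms(3) by (auto simp: DE_def)
  then obtain v0 w0 where e0: "(v0, w0) \<in> edges Q - edges R" using R(2) by auto
  have "polytope_facet (DE R) (DE Q) \<longleftrightarrow> DE R face_of DE Q"
    by (simp add: polytope_facet_def assms(3))
  also have "\<dots> \<longleftrightarrow> ?one \<or> ?two"
  proof
    assume "DE R face_of DE Q"
    then obtain f :: "'v \<Rightarrow> real" and c where eq: "\<And>v w. (v, w) \<in> edges R \<Longrightarrow> f v - f w = c"
      and lt: "\<And>v w. (v, w) \<in> edges Q - edges R \<Longrightarrow> f v - f w < c"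
      unfolding DE_face_iff[OF assms(1) R(2)] by blast
    have rank: "rank_function R (\<lambda>v. - f v / c)" if "c \<noteq> 0"
      using that eq by (fastforce simp: rank_function_def field_simps)
    \<comment> \<open>A rank function of \<open>Q\<close> is one of \<open>R\<close>, so the Boolean
      term can only stay or rise by one from \<open>Q\<close> to \<open>R\<close>; the component
      count supplies the rest of the total rise of one.\<close>
    consider (one) "card (pi0 R) = card (pi0 Q) + 1" "(\<exists>\<rho>. rank_function R \<rho>) \<longleftrightarrow> (\<exists>\<rho>. rank_function Q \<rho>)"
      | (two) "card (pi0 R) = card (pi0 Q)"
      using dims rank_mono by (auto simp: of_bool_def split: if_splits)
    then show "?one \<or> ?two"
    proof cases
      case one
      \<comment> \<open>Adding a multiple of a rank function of \<open>Q\<close> to \<open>f\<close> makes the level \<open>c\<close> vanish.\<close>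
      obtain g where g: "\<And>v w. (v, w) \<in> edges R \<Longrightarrow> g v = g w"
        "\<And>v w. (v, w) \<in> edges Q - edges R \<Longrightarrow> g v < (g w :: real)"
      proof (cases "c = 0")
        case True
        then show ?thesis using that[of f] eq lt by force
      next
        case False
        then obtain \<rho> where "rank_function Q \<rho>" using one(2) rank by blast
        then have \<rho>: "\<rho> w = \<rho> v + 1" if "(v, w) \<in> edges Q" for v w
          using that by (auto simp: rank_function_def)
        show ?thesis
        proof (rule that[of "\<lambda>v. f v + c * \<rho> v"])
          show "f v + c * \<rho> v = f w + c * \<rho> w" if "(v, w) \<in> edges R" for v w
            using eq[OF that] \<rho>[of v w] R(2) that by (auto simp: algebra_simps)
          show "f v + c * \<rho> v < f w + c * \<rho> w" if "(v, w) \<in> edges Q - edges R" for v w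
            using lt[OF that] \<rho>[of v w] that by (auto simp: algebra_simps)
        qed
      qed
      then show ?thesis using one(1) level_imp_acyclic_contraction[OF assms(1,2), of g] by blast
    next
      case two
      \<comment> \<open>Equal component counts give equal spans of edge vectors. With
        \<open>c = 0\<close>, \<open>f\<close> would be orthogonal to those of \<open>R\<close>,
        hence to that of \<open>(v0, w0)\<close>, against the strict inequality there.\<close>
      have "c \<noteq> 0"
      proof
        assume c: "c = 0"
        have "dim (edge_vec ` edges Q) = dim (edge_vec ` edges R)"
          using dim_edge_vecs[OF assms(1)] dim_edge_vecs[OF R(1)] two R(3) by simp
        then have "span (edge_vec ` edges R) = span (edge_vec ` edges Q)"
          using R(2) by (intro dim_eq_span) auto
        then have "edge_vec (v0, w0) \<in> span (edge_vec ` edges R)"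
          using e0 by (auto intro: span_base)
        moreover have "orthogonal (\<chi> i. f i) y" if y: "y \<in> edge_vec ` edges R" for y
        proof -
          obtain v w where "y = edge_vec (v, w)" "(v, w) \<in> edges R" using y by auto
          then show ?thesis using eq[of v w] c by (simp add: orthogonal_def inner_edge_vec)
        qed
        ultimately have "orthogonal (\<chi> i. f i) (edge_vec (v0, w0))"
          by (rule orthogonal_to_span)
        then show False using lt[OF e0] c by (simp add: orthogonal_def inner_edge_vec)
      qed
      let ?\<rho> = "\<lambda>v. - f v / c"
      have "(?\<rho> v - ?\<rho> w + 1) * (?\<rho> v' - ?\<rho> w' + 1) > 0"
        if "(v, w) \<in> edges Q - edges R" "(v', w') \<in> edges Q - edges R" for v w v' w'
      proof -
        \<comment> \<open>Each factor is the slack \<open>c - (f x - f y)\<close> over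
          \<open>c\<close>; the slack is positive outside \<open>R\<close>, so all factors share the
          sign of \<open>c\<close>.\<close>
        have *: "?\<rho> x - ?\<rho> y + 1 = (c - (f x - f y)) / c" for x y
          using \<open>c \<noteq> 0\<close> by (simp add: field_simps)
        have "(c - (f v - f w)) * (c - (f v' - f w')) > 0"
          using lt[OF that(1)] lt[OF that(2)] by (intro mult_pos_pos) simp_all
        then have "(c - (f v - f w)) * (c - (f v' - f w')) / (c * c) > 0"
          using \<open>c \<noteq> 0\<close> by (intro divide_pos_pos) (auto simp: zero_less_mult_iff)
        then show ?thesis unfolding * by (simp add: times_divide_times_eq)
      qed
      then have ?two using two rank[OF \<open>c \<noteq> 0\<close>] by (intro conjI exI[of _ ?\<rho>]) auto
      then show ?thesis ..
    qed
  next
    assume "?one \<or> ?two"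
    then show "DE R face_of DE Q"
    proof
      assume ?one
      then obtain f :: "'v \<Rightarrow> real" where "\<And>v w. (v, w) \<in> edges R \<Longrightarrow> f v = f w"
        "\<And>v w. (v, w) \<in> edges Q - edges R \<Longrightarrow> f v < f w"
        using acyclic_contraction_imp_level[OF assms(2)] by metis
      then show ?thesis unfolding DE_face_iff[OF assms(1) R(2)]
        by (intro exI[of _ f] exI[of _ 0]) auto
    next
      assume ?two
      then obtain \<rho> :: "'v \<Rightarrow> real" where \<rho>: "\<And>v w. (v, w) \<in> edges R \<Longrightarrow> \<rho> v + 1 = \<rho> w"
        and sgn: "\<And>v w. (v, w) \<in> edges Q - edges R \<Longrightarrow> (\<rho> v0 - \<rho> w0 + 1) * (\<rho> v - \<rho> w + 1) > 0"
        using e0 unfolding rank_function_def by blast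
      \<comment> \<open>By hypothesis every edge outside \<open>R\<close> gives an expression of the
        same sign as \<open>?s\<close>. Scaling \<open>- \<rho>\<close> by \<open>?s\<close>
        therefore yields level \<open>?s\<close> on \<open>R\<close>, and the slack on any other
        edge is one of the positive products.\<close>
      let ?s = "\<rho> v0 - \<rho> w0 + 1"
      show ?thesis unfolding DE_face_iff[OF assms(1) R(2)]
      proof (intro exI[of _ "\<lambda>v. - ?s * \<rho> v"] exI[of _ ?s] conjI ballI; clarify)
        fix v w assume "(v, w) \<in> edges R"
        then have "\<rho> w = \<rho> v + 1" by (rule \<rho>[symmetric])
        then show "- ?s * \<rho> v - - ?s * \<rho> w = ?s" by (simp add: algebra_simps)
      next
        fix v w assume "(v, w) \<in> edges Q" "(v, w) \<notin> edges R"
        then show "- ?s * \<rho> v - - ?s * \<rho> w < ?s" using sgn[of v w] by (simp add: algebra_simps)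
      qed
    qed
  qed
  finally show ?thesis .
qed

end
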